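(* Let $(X,d)$ be a finite ultrametric space with $|X|=n\ge 2$. The following conditions are equivalent. (i) $(X,d)\in\mathfrak{R}$, i.e. $\min_{g\in\operatorname{Iso}(X)}|\operatorname{Fix}(g)|=|X|-2$. (ii) There exists a minimum spanning path $P\in\mathfrak{P}_{min}(X)$ such that the path spectrum $\mathcal{PS}(P)=(s_1,\dots,s_{n-1})$ is a strictly monotone sequence.
   Context: An ultrametric space $(X,d)$ is a metric space with $d(x,y)\le\max\{d(x,z),d(z,y)\}$ for all $x,y,z$. $\operatorname{Iso}(X)$ is the group of isometries of $(X,d)$ and $\operatorname{Fix}(g)$ is the set of fixed points of $g\colon X\to X$. $\mathfrak{R}$ denotes the class of finite ultrametric spaces ("as rigid as possible") satisfying $\min_{g\in\operatorname{Iso}(X)}|\operatorname{Fix}(g)|=|X|-2$. Minimum spanning paths: a finite metric space $(X,d)$ is regarded as the complete weighted graph $(G_X,w)$ with $V(G_X)=X$ and $w(\{x,y\})=d(x,y)$ for $x\ne y$. A minimum spanning tree of $(X,d)$ is a spanning tree of $G_X$ whose sum of edge weights is smallest among all spanning trees. $\mathfrak{P}_{min}(X)$ is the set of all minimum spanning paths, i.e. minimum spanning trees that are paths (a path is a nonempty graph with vertices $x_1,\dots,x_n$ and edges exactly $\{x_1,x_2\},\dots,\{x_{n-1},x_n\}$). For $P\in\mathfrak{P}_{min}(X)$ with vertices numbered $x_1,\dots,x_n$ along $P$, the path spectrum is $\mathcal{PS}(P)=(s_1,\dots,s_{n-1})$, $s_i=d(x_i,x_{i+1})$. Strictly monotone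 means strictly increasing or strictly decreasing. *)

theory Defs
  imports "HOL-Analysis.Analysis"
begin

subsection \<open>Ultrametric spaces and their isometries\<close>

locale Ultrametric_space = Metric_space X d for X :: "'a set" and d +
  assumes ultra: "\<lbrakk>x \<in> X; y \<in> X; z \<in> X\<rbrakk> \<Longrightarrow> d x y \<le> max (d x z) (d z y)"

text \<open>Requiring extensionality makes every isometry of the space \<open>X\<close> be represented by
  exactly one function on the ambient type.\<close>

definition Iso :: "'a set \<Rightarrow> ('a \<Rightarrow> 'a \<Rightarrow> real) \<Rightarrow> ('a \<Rightarrow> 'a) set" where
  "Iso X d = {g \<in> extensional X. bij_betw g X X \<and> (\<forall>x\<in>X. \<forall>y\<in>X. d (g x) (g y) = d x y)}"

definition Fix :: "'a set \<Rightarrow> ('a \<Rightarrow> 'a) \<Rightarrow> 'a set" where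
  "Fix X g = {x \<in> X. g x = x}"

text \<open>The equation is stated over the integers since subtraction on \<^typ>\<open>nat\<close> truncates.\<close>

definition as_rigid_as_possible :: "('a set \<times> ('a \<Rightarrow> 'a \<Rightarrow> real)) set" where
  "as_rigid_as_possible = {(X, d). Ultrametric_space X d \<and> finite X \<and>
     int (Min ((\<lambda>g. card (Fix X g)) ` Iso X d)) = int (card X) - 2}"

subsection \<open>Simple graphs, trees and paths\<close>

text \<open>A graph is a pair of a vertex set and a set of edges, an edge being a two-element set
  of vertices.\<close>

type_synonym 'a ugraph = "'a set \<times> 'a set set"

definition simple_graph :: "'a ugraph \<Rightarrow> bool" where
  "simple_graph G \<longleftrightarrow> (\<forall>e\<in>snd G. e \<subseteq> fst G \<and> card e = 2)"

definition complete_graph :: "'a set \<Rightarrow> 'a ugraph" where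
  "complete_graph X = (X, {{x, y} | x y. x \<in> X \<and> y \<in> X \<and> x \<noteq> y})"

definition connected_graph :: "'a ugraph \<Rightarrow> bool" where
  "connected_graph G \<longleftrightarrow> fst G \<noteq> {} \<and>
     (\<forall>u\<in>fst G. \<forall>v\<in>fst G. (u, v) \<in> {(x, y). {x, y} \<in> snd G}\<^sup>*)"

text \<open>The list of the distinct vertices of a cycle, without repeating the initial vertex
  at the end.\<close>

definition is_cycle :: "'a ugraph \<Rightarrow> 'a list \<Rightarrow> bool" where
  "is_cycle G c \<longleftrightarrow> length c \<ge> 3 \<and> distinct c \<and>
     (\<forall>i. Suc i < length c \<longrightarrow> {c ! i, c ! Suc i} \<in> snd G) \<and> {last c, hd c} \<in> snd G"

definition is_tree :: "'a ugraph \<Rightarrow> bool" where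
  "is_tree T \<longleftrightarrow> simple_graph T \<and> connected_graph T \<and> (\<nexists>c. is_cycle T c)"

definition is_spanning_tree :: "'a ugraph \<Rightarrow> 'a ugraph \<Rightarrow> bool" where
  "is_spanning_tree T G \<longleftrightarrow> is_tree T \<and> fst T = fst G \<and> snd T \<subseteq> snd G"

text \<open>\<open>path_numbering P xs\<close>: the graph \<open>P\<close> is a path, and \<open>xs\<close> lists its vertices along the path.
  A path has exactly two such numberings (one if it has a single vertex), which are reverses
  of each other.\<close>

definition path_numbering :: "'a ugraph \<Rightarrow> 'a list \<Rightarrow> bool" where
  "path_numbering P xs \<longleftrightarrow> xs \<noteq> [] \<and> distinct xs \<and>
     P = (set xs, {{xs ! i, xs ! Suc i} | i. Suc i < length xs})"

subsection \<open>Minimum spanning paths of a metric space\<close>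

definition edge_weight :: "('a \<Rightarrow> 'a \<Rightarrow> real) \<Rightarrow> 'a set \<Rightarrow> real" where
  "edge_weight d e = (THE r. \<exists>x y. e = {x, y} \<and> x \<noteq> y \<and> r = d x y)"

lemma (in Metric_space) edge_weight_doubleton: "x \<noteq> y \<Longrightarrow> edge_weight d {x, y} = d x y"
  unfolding edge_weight_def by (rule the_equality) (auto simp: doubleton_eq_iff commute)

definition total_weight :: "('a \<Rightarrow> 'a \<Rightarrow> real) \<Rightarrow> 'a ugraph \<Rightarrow> real" where
  "total_weight d G = (\<Sum>e\<in>snd G. edge_weight d e)"

definition is_min_spanning_tree :: "'a set \<Rightarrow> ('a \<Rightarrow> 'a \<Rightarrow> real) \<Rightarrow> 'a ugraph \<Rightarrow> bool" where
  "is_min_spanning_tree X d T \<longleftrightarrow> is_spanning_tree T (complete_graph X) \<and>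
     (\<forall>T'. is_spanning_tree T' (complete_graph X) \<longrightarrow> total_weight d T \<le> total_weight d T')"

definition min_spanning_paths :: "'a set \<Rightarrow> ('a \<Rightarrow> 'a \<Rightarrow> real) \<Rightarrow> 'a ugraph set" where
  "min_spanning_paths X d = {P. is_min_spanning_tree X d P \<and> (\<exists>xs. path_numbering P xs)}"

definition path_spectrum :: "('a \<Rightarrow> 'a \<Rightarrow> real) \<Rightarrow> 'a list \<Rightarrow> real list" where
  "path_spectrum d xs = map (\<lambda>i. d (xs ! i) (xs ! Suc i)) [0..<length xs - 1]"

definition strictly_monotone :: "real list \<Rightarrow> bool" where
  "strictly_monotone s \<longleftrightarrow> sorted_wrt (<) s \<or> sorted_wrt (>) s"

end

theory Submission
  imports Defs "HOL-Combinatorics.Transposition"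
begin

text \<open>
  Call two points twins if every third point is equidistant from them, so that exchanging them
  is an isometry with exactly \<open>|X| - 2\<close> fixed points. In an ultrametric space a pair of points
  at minimal distance consists of twins, by the isosceles property. The minimum in the definition
  of rigidity is therefore never larger than \<open>|X| - 2\<close>, and rigidity says that no isometry moves
  more than two points. Since the product of two different twin swaps moves at least three points,
  a rigid space has only one pair of twins (\<open>rigid_imp_unique_twins\<close>).

  A space with a single pair of twins is a comb: its points can be listed so that the distance
  of two of them depends only on the later one and increases with it
  (\<open>unique_twins_imp_comb\<close>). For let \<open>D\<close> be the diameter, attained at \<open>a\<close> and \<open>b\<close>, and split
  the space into the points at distance less than \<open>D\<close> from \<open>a\<close> and those at distance \<open>D\<close>. All
  distances across the split equal \<open>D\<close>, so a closest pair inside either part consists of twins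
  of the whole space. Hence one of the parts is a single point, which is put last, and
  the remaining points are again a space with one pair of twins. Conversely, in a comb every point
  but the first two is determined by its distance to a nearest other point, so isometries fix it
  (\<open>comb_isometry_fixes\<close>).

  It remains to match combs with monotone spanning paths. A listing is a comb if and
  only if the distances of consecutive points increase strictly, again by the isosceles property
  (\<open>comb_iff_sorted_spectrum\<close>), and a decreasing listing can be reversed. Finally, the path along
  a comb is a minimum spanning tree (\<open>comb_path_minimal\<close>): root an arbitrary spanning tree at the
  first point and assign to every other point the edge towards the root. These edges are distinct,
  and the one assigned to a point weighs at least as much as the step of the path leading to that
  point, which has the smallest weight of all edges at the point.
\<close>

section \<open>Twins and isometries\<close>

definition twins :: "'a set \<Rightarrow> ('a \<Rightarrow> 'a \<Rightarrow> real) \<Rightarrow> 'a \<Rightarrow> 'a \<Rightarrow> bool" where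
  "twins S d p q \<longleftrightarrow> p \<in> S \<and> q \<in> S \<and> p \<noteq> q \<and> (\<forall>z\<in>S - {p, q}. d p z = d q z)"

definition unique_twins :: "'a set \<Rightarrow> ('a \<Rightarrow> 'a \<Rightarrow> real) \<Rightarrow> bool" where
  "unique_twins S d \<longleftrightarrow> (\<forall>p q r s. twins S d p q \<longrightarrow> twins S d r s \<longrightarrow> {p, q} = {r, s})"

lemma finite_Iso:
  assumes "finite X"
  shows "finite (Iso X d)"
proof (rule finite_subset)
  show "Iso X d \<subseteq> X \<rightarrow>\<^sub>E X"
    by (auto simp: Iso_def PiE_def bij_betw_def)
  show "finite (X \<rightarrow>\<^sub>E X)"
    using assms by (intro finite_PiE) auto
qed

lemma compose_in_Iso:
  assumes "g \<in> Iso X d" "h \<in> Iso X d"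
  shows "compose X g h \<in> Iso X d"
proof -
  have "bij_betw (compose X g h) X X"
    using assms by (auto simp: Iso_def intro: bij_betw_compose)
  moreover have "h x \<in> X" if "x \<in> X" for x
    using assms(2) that by (auto simp: Iso_def bij_betw_def)
  ultimately show ?thesis
    using assms by (simp add: Iso_def compose_eq)
qed

context Ultrametric_space
begin

lemma twins_swap_in_Iso:
  assumes "twins X d p q"
  shows "restrict (Transposition.transpose p q) X \<in> Iso X d"
proof -
  have pq: "p \<in> X" "q \<in> X" "p \<noteq> q" and eq: "\<And>z. z \<in> X \<Longrightarrow> z \<noteq> p \<Longrightarrow> z \<noteq> q \<Longrightarrow> d p z = d q z"
    using assms by (auto simp: twins_def)
  have "bij_betw (Transposition.transpose p q) X X"
    using pq by simp
  then have "bij_betw (restrict (Transposition.transpose p q) X) X X"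
    by (simp add: bij_betw_restrict_eq)
  moreover have "d (Transposition.transpose p q x) (Transposition.transpose p q y) = d x y"
    if "x \<in> X" "y \<in> X" for x y
  proof -
    consider "x = p" | "x = q" | "x \<noteq> p" "x \<noteq> q" by blast
    then show ?thesis
    proof cases
      case 1
      then show ?thesis
        using pq eq[OF that(2)] commute[of q p] by (simp add: Transposition.transpose_def)
    next
      case 2
      then show ?thesis
        using pq eq[OF that(2)] commute[of q p] by (simp add: Transposition.transpose_def)
    next
      case 3
      then show ?thesis
        using eq[OF that(1)] commute[of x p] commute[of x q]
        by (simp add: Transposition.transpose_def)
    qed
  qed
  ultimately show ?thesis
    by (simp add: Iso_def)
qed

text \<open>Any two points \<open>p\<close>, \<open>q\<close> of \<open>T\<close> at minimal distance will do: if \<open>z\<close> lies in \<open>T\<close>, then \<open>pq\<close> is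
  a shortest side of the triangle \<open>pqz\<close>, and in an ultrametric space the other two sides are
  equal; the points outside \<open>T\<close> are covered by the hypothesis.\<close>

lemma closest_pair_twins:
  assumes "S \<subseteq> X" "T \<subseteq> S" "finite T" "card T \<ge> 2"
    and eq: "\<And>p q z. p \<in> T \<Longrightarrow> q \<in> T \<Longrightarrow> z \<in> S - T \<Longrightarrow> d p z = d q z"
  obtains p q where "p \<in> T" "q \<in> T" "twins S d p q"
proof -
  define R where "R = {u \<in> T \<times> T. fst u \<noteq> snd u}"
  have "finite R" using \<open>finite T\<close> by (simp add: R_def)
  moreover have "R \<noteq> {}"
  proof -
    obtain x y where "x \<in> T" "y \<in> T" "x \<noteq> y"
      using \<open>card T \<ge> 2\<close> \<open>finite T\<close>
      by (metis card_le_Suc0_iff_eq not_less_eq_eq numeral_2_eq_2)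
    then show ?thesis by (auto simp: R_def)
  qed
  ultimately obtain u where u: "u \<in> R" "\<And>v. v \<in> R \<Longrightarrow> d (fst u) (snd u) \<le> d (fst v) (snd v)"
    using arg_min_least[of R _ "\<lambda>u. d (fst u) (snd u)"]
      arg_min_if_finite(1)[of R "\<lambda>u. d (fst u) (snd u)"] by blast
  obtain p q where pq: "u = (p, q)" by fastforce
  have mem: "p \<in> T" "q \<in> T" "p \<noteq> q" using u pq by (auto simp: R_def)
  have min: "d p q \<le> d x y" if "x \<in> T" "y \<in> T" "x \<noteq> y" for x y
    using u(2)[of "(x, y)"] that pq by (simp add: R_def)
  have "d p z = d q z" if z: "z \<in> S" "z \<noteq> p" "z \<noteq> q" for z
  proof (cases "z \<in> T")
    case True
    have X: "p \<in> X" "q \<in> X" "z \<in> X" using mem True assms by auto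
    have "d p z \<le> max (d p q) (d q z)" "d q z \<le> max (d p q) (d p z)"
      using ultra[OF X(1,3,2)] ultra[OF X(2,3,1)] commute[of q p] by simp_all
    moreover have "d p q \<le> d p z" "d p q \<le> d q z"
      using min[OF mem(1) True] min[OF mem(2) True] z by blast+
    ultimately show ?thesis
      by linarith
  next
    case False
    then show ?thesis using eq[OF mem(1,2)] z by blast
  qed
  then have "twins S d p q" using mem \<open>T \<subseteq> S\<close> by (auto simp: twins_def)
  then show ?thesis using that mem by blast
qed

lemma card_Fix_swap:
  assumes "finite X" "twins X d p q"
  shows "card (Fix X (restrict (Transposition.transpose p q) X)) = card X - 2"
proof -
  have pq: "p \<in> X" "q \<in> X" "p \<noteq> q"
    using assms(2) by (auto simp: twins_def)
  then have "Fix X (restrict (Transposition.transpose p q) X) = X - {p, q}"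
    by (auto simp: Fix_def Transposition.transpose_def split: if_splits)
  then show ?thesis
    using pq by (simp add: card_Diff_subset)
qed

text \<open>A twin swap attains the value \<open>|X| - 2\<close>, so only the lower bound has to be required.\<close>

lemma as_rigid_as_possible_iff:
  assumes "finite X" "card X \<ge> 2"
  shows "(X, d) \<in> as_rigid_as_possible \<longleftrightarrow> (\<forall>g\<in>Iso X d. card X - 2 \<le> card (Fix X g))"
proof -
  let ?F = "(\<lambda>g. card (Fix X g)) ` Iso X d"
  obtain p q where "twins X d p q"
    by (rule closest_pair_twins[of X X]) (use assms in auto)
  then have mem: "card X - 2 \<in> ?F"
    using twins_swap_in_Iso card_Fix_swap assms(1) by (metis image_eqI)
  have fin: "finite ?F"
    using finite_Iso[OF assms(1)] by simp
  have "(X, d) \<in> as_rigid_as_possible \<longleftrightarrow> Min ?F = card X - 2"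
    using assms Ultrametric_space_axioms by (auto simp: as_rigid_as_possible_def)
  also have "\<dots> \<longleftrightarrow> (\<forall>k\<in>?F. card X - 2 \<le> k)"
    using fin mem by (metis Min_eqI Min_le)
  finally show ?thesis by simp
qed

text \<open>Two different twin pairs involve at least three points, and the product of the two swaps
  moves all of them.\<close>

lemma rigid_imp_unique_twins:
  assumes "finite X" "card X \<ge> 2" and rigid: "\<forall>g\<in>Iso X d. card X - 2 \<le> card (Fix X g)"
  shows "unique_twins X d"
proof (rule ccontr)
  assume "\<not> unique_twins X d"
  then obtain p q r s where tw: "twins X d p q" "twins X d r s" and ne: "{p, q} \<noteq> {r, s}"
    unfolding unique_twins_def by blast
  define g where "g = compose X (restrict (Transposition.transpose p q) X)
    (restrict (Transposition.transpose r s) X)"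
  have "g \<in> Iso X d"
    unfolding g_def by (intro compose_in_Iso twins_swap_in_Iso tw)
  have mem: "p \<in> X" "q \<in> X" "r \<in> X" "s \<in> X" and pq: "p \<noteq> q" and rs: "r \<noteq> s"
    using tw by (auto simp: twins_def)
  have "Fix X g \<subseteq> X - {p, q, r, s}"
  proof
    fix x assume "x \<in> Fix X g"
    then have x: "x \<in> X" "g x = x" by (auto simp: Fix_def)
    have "Transposition.transpose r s x \<in> X"
      using x(1) mem by (auto simp: Transposition.transpose_def)
    then have "Transposition.transpose p q (Transposition.transpose r s x) = x"
      using x by (simp add: g_def compose_eq)
    then have "Transposition.transpose r s x = Transposition.transpose p q x"
      by (metis transpose_involutory)
    \<comment> \<open>On a point of one of the pairs the swaps could agree only if the pairs were equal.\<close>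
    then have "x \<notin> {p, q, r, s}"
      using pq rs ne by (auto simp: Transposition.transpose_def split: if_splits)
    then show "x \<in> X - {p, q, r, s}" using x by simp
  qed
  then have "card (Fix X g) \<le> card X - card {p, q, r, s}"
    using assms(1) mem by (metis (no_types) card_Diff_subset card_mono empty_subsetI finite.emptyI
        finite_Diff finite_insert insert_subset)
  moreover have "card {p, q, r, s} \<ge> 3"
    using pq rs ne by (auto simp: card_insert_if doubleton_eq_iff)
  moreover have "card {p, q, r, s} \<le> card X"
    using mem assms(1) by (intro card_mono) auto
  ultimately show False
    using rigid \<open>g \<in> Iso X d\<close> by fastforce
qed

end

section \<open>Combs\<close>

text \<open>The distance matrix of such a list is constant along the part of each column above the
  diagonal, and these constants increase. The column \<open>j\<close> is represented by its entry
  \<open>d (xs ! 0) (xs ! j)\<close> in the first row, which is why the monotonicity condition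
  starts at column 1.
  The name refers to the shape of the tree of balls of the space.\<close>

definition comb :: "('a \<Rightarrow> 'a \<Rightarrow> real) \<Rightarrow> 'a list \<Rightarrow> bool" where
  "comb d xs \<longleftrightarrow> distinct xs \<and>
     (\<forall>i j. i < j \<and> j < length xs \<longrightarrow> d (xs ! i) (xs ! j) = d (xs ! 0) (xs ! j)) \<and>
     (\<forall>i j. 0 < i \<and> i < j \<and> j < length xs \<longrightarrow> d (xs ! 0) (xs ! i) < d (xs ! 0) (xs ! j))"

text \<open>The column equation rewrites its own right-hand side when used as a simplification rule,
  hence the conditions are made available separately.\<close>

lemma combD:
  assumes "comb d xs"
  shows comb_distinct: "distinct xs"
    and comb_column: "i < j \<Longrightarrow> j < length xs \<Longrightarrow> d (xs ! i) (xs ! j) = d (xs ! 0) (xs ! j)"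
    and comb_less: "0 < i \<Longrightarrow> i < j \<Longrightarrow> j < length xs \<Longrightarrow> d (xs ! 0) (xs ! i) < d (xs ! 0) (xs ! j)"
  using assms unfolding comb_def by blast+

lemma sorted_path_spectrum_iff:
  "sorted_wrt (<) (path_spectrum d xs) \<longleftrightarrow>
     (\<forall>i j. i < j \<and> Suc j < length xs \<longrightarrow> d (xs ! i) (xs ! Suc i) < d (xs ! j) (xs ! Suc j))"
  by (auto simp: path_spectrum_def sorted_wrt_iff_nth_less)

context Ultrametric_space
begin

lemma comb_dist:
  assumes "comb d xs" "i < length xs" "j < length xs" "i \<noteq> j"
  shows "d (xs ! i) (xs ! j) = d (xs ! 0) (xs ! max i j)"
proof (cases "i < j")
  case True
  then show ?thesis using comb_column[OF assms(1), of i j] assms by simp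
next
  case False
  then have "j < i" using assms by simp
  then show ?thesis
    using comb_column[OF assms(1), of j i] assms commute[of "xs ! i" "xs ! j"] by simp
qed

text \<open>In a triangle formed by \<open>xs ! i\<close>, \<open>xs ! j\<close> and \<open>xs ! Suc j\<close> with \<open>i < j\<close>, the side between
  the first two points equals the step into \<open>xs ! j\<close> by induction, which is shorter than the step
  out of it. The two longest sides of an ultrametric triangle being equal, the distance from
  \<open>xs ! i\<close> to \<open>xs ! Suc j\<close> is the length of that last step.\<close>

lemma comb_iff_sorted_spectrum:
  assumes "set xs \<subseteq> X" "distinct xs"
  shows "comb d xs \<longleftrightarrow> sorted_wrt (<) (path_spectrum d xs)"
proof
  assume comb: "comb d xs"
  have "d (xs ! i) (xs ! Suc i) = d (xs ! 0) (xs ! Suc i)" if "Suc i < length xs" for i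
    using comb_column[OF comb, of i "Suc i"] that by simp
  then show "sorted_wrt (<) (path_spectrum d xs)"
    using comb_less[OF comb] by (simp add: sorted_path_spectrum_iff)
next
  assume sorted: "sorted_wrt (<) (path_spectrum d xs)"
  have mem: "xs ! i \<in> X" if "i < length xs" for i
    using assms(1) that by auto
  have step: "d (xs ! i) (xs ! j) = d (xs ! (j - 1)) (xs ! j)" if "i < j" "j < length xs" for i j
    using that
  proof (induction j)
    case (Suc j)
    show ?case
    proof (cases "i = j")
      case False
      then have "i < j" using Suc.prems by simp
      then have "d (xs ! i) (xs ! j) < d (xs ! j) (xs ! Suc j)"
        using sorted Suc by (auto simp: sorted_path_spectrum_iff dest: spec[of _ "j - 1"])
      then show ?thesis
        using ultra[of "xs ! i" "xs ! Suc j" "xs ! j"] ultra[of "xs ! j" "xs ! Suc j" "xs ! i"]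
          mem[of i] mem[of j] mem[of "Suc j"] Suc.prems commute[of "xs ! i" "xs ! j"]
        by auto
    qed simp
  qed simp
  have first: "d (xs ! 0) (xs ! j) = d (xs ! (j - 1)) (xs ! j)" if "0 < j" "j < length xs" for j
    using step that by blast
  have "d (xs ! 0) (xs ! i) < d (xs ! 0) (xs ! j)" if "0 < i" "i < j" "j < length xs" for i j
  proof -
    have "d (xs ! (i - 1)) (xs ! Suc (i - 1)) < d (xs ! (j - 1)) (xs ! Suc (j - 1))"
      using sorted that unfolding sorted_path_spectrum_iff by (metis Suc_less_eq Suc_pred' less_trans)
    then show ?thesis using first[of i] first[of j] that by simp
  qed
  moreover have "d (xs ! i) (xs ! j) = d (xs ! 0) (xs ! j)" if "i < j" "j < length xs" for i j
    using step[of i j] first[of j] that by simp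
  ultimately show "comb d xs"
    using assms(2) unfolding comb_def by blast
qed

lemma strictly_monotone_spectrum_imp_comb:
  assumes "set xs = X" "distinct xs" "strictly_monotone (path_spectrum d xs)"
  obtains ys where "set ys = X" "comb d ys"
proof -
  have "path_spectrum d (rev xs) = rev (path_spectrum d xs)"
    by (rule nth_equalityI)
      (auto simp: path_spectrum_def rev_nth commute Suc_diff_Suc)
  then have "sorted_wrt (<) (path_spectrum d xs) \<or> sorted_wrt (<) (path_spectrum d (rev xs))"
    using assms(3) by (auto simp: strictly_monotone_def sorted_wrt_rev)
  then have "comb d xs \<or> comb d (rev xs)"
    using comb_iff_sorted_spectrum[of xs] comb_iff_sorted_spectrum[of "rev xs"] assms(1,2) by auto
  then show ?thesis
    using that[of xs] that[of "rev xs"] assms(1) by auto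
qed

text \<open>The smallest distance from \<open>xs ! j\<close> to another point is the constant of column \<open>j\<close>, and of
  column 1 if \<open>j = 0\<close>. It is invariant under isometries and distinguishes all points except the
  first two. The two cases compare it for \<open>xs ! j\<close> and its image \<open>xs ! k\<close>.\<close>

lemma comb_isometry_fixes:
  assumes comb: "comb d xs" and X: "set xs = X" and g: "g \<in> Iso X d"
    and j: "2 \<le> j" "j < length xs"
  shows "g (xs ! j) = xs ! j"
proof -
  let ?f = "\<lambda>j. d (xs ! 0) (xs ! j)"
  have less: "?f i < ?f k" if "0 < i" "i < k" "k < length xs" for i k
    using comb_less[OF comb] that by blast
  have surj: "g ` X = X" and iso: "\<And>x y. x \<in> X \<Longrightarrow> y \<in> X \<Longrightarrow> d (g x) (g y) = d x y"
    using g by (auto simp: Iso_def bij_betw_def)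
  have inX: "xs ! i \<in> X" if "i < length xs" for i
    using that X by auto
  obtain k where k: "k < length xs" "g (xs ! j) = xs ! k"
    using surj inX[OF j(2)] X by (metis image_eqI in_set_conv_nth)
  have "\<not> j < k"
  proof
    assume "j < k"
    obtain i where i: "i < length xs" "g (xs ! 0) = xs ! i"
      using surj inX[of 0] X j by (metis image_eqI in_set_conv_nth less_nat_zero_code
          linorder_neqE_nat)
    have eq: "d (xs ! i) (xs ! k) = ?f j"
      using iso[OF inX inX[OF j(2)], of 0] i(2) k(2) j by force
    have "?f j > 0"
      using less[of 1 j] j nonneg[of "xs ! 0" "xs ! 1"] by linarith
    then have "i \<noteq> k"
      using eq inX[OF k(1)] by auto
    then have "?f (max i k) = ?f j"
      using comb_dist[OF comb i(1) k(1)] eq by simp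
    then show False
      using less[of j "max i k"] \<open>j < k\<close> i k j by (simp add: less_max_iff_disj)
  qed
  moreover have "\<not> k < j"
  proof
    assume "k < j"
    \<comment> \<open>A point nearest to \<open>xs ! k\<close>.\<close>
    define l :: nat where "l = (if k = 0 then 1 else 0)"
    have l: "l < length xs" "l \<noteq> k" "0 < max l k" "max l k < j"
      using j \<open>k < j\<close> by (auto simp: l_def)
    obtain i where i: "i < length xs" "g (xs ! i) = xs ! l"
      using surj inX[OF l(1)] X by (metis imageE in_set_conv_nth)
    have "i \<noteq> j"
      using i k l nth_eq_iff_index_eq[of xs l k] comb_distinct[OF comb] by auto
    have "?f (max i j) = d (xs ! i) (xs ! j)"
      using comb_dist[OF comb i(1) j(2)] \<open>i \<noteq> j\<close> by simp
    also have "\<dots> = d (xs ! l) (xs ! k)"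
      using iso[of "xs ! i" "xs ! j"] i k inX j by simp
    also have "\<dots> = ?f (max l k)"
      using comb_dist[OF comb l(1) k(1) l(2)] .
    finally show False
      using less[OF l(3), of "max i j"] less_le_trans[OF l(4), of "max i j"] i j by simp
  qed
  ultimately show ?thesis
    using k by simp
qed

lemma comb_imp_rigid:
  assumes "comb d xs" "set xs = X" "g \<in> Iso X d"
  shows "card X - 2 \<le> card (Fix X g)"
proof -
  have len: "length xs = card X"
    using assms distinct_card[OF comb_distinct] by metis
  have "(!) xs ` {2..<length xs} \<subseteq> Fix X g"
    using comb_isometry_fixes[OF assms] assms(2) by (auto simp: Fix_def)
  moreover have "inj_on ((!) xs) {2..<length xs}"
    using comb_distinct[OF assms(1)] by (auto intro: inj_on_nth)
  moreover have "finite (Fix X g)"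
    using assms(2) by (auto simp: Fix_def)
  ultimately show ?thesis
    using card_mono card_image len by (metis card_atLeastLessThan)
qed

text \<open>Uniqueness of the twins forces a point \<open>c\<close> at distance \<open>D\<close>, the diameter, from all others. It
  also forces the comb of the remaining points to have diameter less than \<open>D\<close>: otherwise its last
  point would be a twin of \<open>c\<close>, besides the twins found without \<open>c\<close>.\<close>

lemma unique_twins_imp_comb:
  assumes "S \<subseteq> X" "finite S" "card S \<ge> 2" "unique_twins S d"
  shows "\<exists>xs. set xs = S \<and> comb d xs"
  using assms(2,1,3,4)
proof (induction S rule: finite_psubset_induct)
  case (psubset S)
  show ?case
  proof (cases "card S = 2")
    case True
    then obtain x y where "S = {x, y}" "x \<noteq> y"
      by (auto simp: card_2_iff)
    then have "set [x, y] = S" "comb d [x, y]"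
      by (auto simp: comb_def less_Suc_eq nth_Cons')
    then show ?thesis by blast
  next
    case False
    then have card3: "card S \<ge> 3" using psubset.prems by simp
    have SX: "x \<in> X" if "x \<in> S" for x using psubset.prems that by auto
    obtain a b where ab: "a \<in> S" "b \<in> S" and max: "\<And>x y. x \<in> S \<Longrightarrow> y \<in> S \<Longrightarrow> d x y \<le> d a b"
    proof -
      have "S \<times> S \<noteq> {}" using card3 by auto
      moreover have "finite (S \<times> S)" using psubset.hyps by simp
      moreover define u where "u = arg_min_on (\<lambda>u. - d (fst u) (snd u)) (S \<times> S)"
      ultimately have u: "u \<in> S \<times> S"
        and least: "\<And>v. v \<in> S \<times> S \<Longrightarrow> - d (fst u) (snd u) \<le> - d (fst v) (snd v)"
        using arg_min_if_finite(1) arg_min_least[where f = "\<lambda>u. - d (fst u) (snd u)"]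
        by (simp_all only: u_def)
      have "d x y \<le> d (fst u) (snd u)" if "x \<in> S" "y \<in> S" for x y
        using least[of "(x, y)"] that by simp
      then show ?thesis using that[of "fst u" "snd u"] u by (metis mem_Times_iff)
    qed
    \<comment> \<open>The part \<open>A\<close> is the open ball of radius \<open>d a b\<close> about \<open>a\<close>; \<open>C\<close> need not be a ball.\<close>
    define A where "A = {z \<in> S. d a z < d a b}"
    define C where "C = S - A"
    have cross: "d x z = d a b" if "x \<in> A" "z \<in> C" for x z
    proof -
      have xz: "d a b \<le> d a z" "x \<in> S" "z \<in> S" "d a x < d a b"
        using that by (auto simp: A_def C_def)
      have "d a z \<le> max (d a x) (d x z)"
        by (intro ultra SX ab xz)
      then show ?thesis
        using max[OF xz(2,3)] xz(1,4) by linarith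
    qed
    have "\<not> (card A \<ge> 2 \<and> card C \<ge> 2)"
    proof (intro notI, elim conjE)
      assume "card A \<ge> 2" "card C \<ge> 2"
      obtain p q where pq: "p \<in> A" "q \<in> A" "twins S d p q"
      proof (rule closest_pair_twins[of S A])
        show "d p z = d q z" if "p \<in> A" "q \<in> A" "z \<in> S - A" for p q z
          using cross[of p z] cross[of q z] that by (simp add: C_def)
      qed (use \<open>card A \<ge> 2\<close> psubset in \<open>auto simp: A_def\<close>)
      obtain r s where rs: "r \<in> C" "s \<in> C" "twins S d r s"
      proof (rule closest_pair_twins[of S C])
        show "d p z = d q z" if "p \<in> C" "q \<in> C" "z \<in> S - C" for p q z
          using cross[of z p] cross[of z q] that commute[of p z] commute[of q z]
          by (auto simp: C_def)
      qed (use \<open>card C \<ge> 2\<close> psubset in \<open>auto simp: C_def\<close>)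
      have "{p, q} = {r, s}"
        using psubset.prems pq rs unfolding unique_twins_def by blast
      then show False
        using pq rs by (auto simp: C_def)
    qed
    have "a \<noteq> b"
    proof
      assume "a = b"
      obtain x y where "x \<in> S" "y \<in> S" "x \<noteq> y"
        using \<open>card S \<ge> 2\<close> psubset.hyps
        by (metis card_le_Suc0_iff_eq not_less_eq_eq numeral_2_eq_2)
      then have "d x y \<le> d a a" "0 < d x y"
        using max[of x y] SX \<open>a = b\<close> by auto
      then show False using SX ab by simp
    qed
    then have "d a b > 0" using ab SX by auto
    then have "a \<in> A" "b \<in> C"
      using ab SX by (auto simp: A_def C_def)
    have "finite A" "finite C" using psubset.hyps by (auto simp: A_def C_def)
    obtain c where c: "c \<in> S" "\<And>z. z \<in> S \<Longrightarrow> z \<noteq> c \<Longrightarrow> d z c = d a b"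
    proof (cases "card A \<ge> 2")
      case True
      then have "card C \<le> Suc 0" using \<open>\<not> (card A \<ge> 2 \<and> card C \<ge> 2)\<close> by simp
      then have "C = {b}" using \<open>finite C\<close> \<open>b \<in> C\<close> card_le_Suc0_iff_eq by blast
      then have "z \<in> A" if "z \<in> S" "z \<noteq> b" for z using that by (auto simp: C_def)
      then show ?thesis using that[of b] cross \<open>b \<in> C\<close> ab by blast
    next
      case False
      then have "card A \<le> Suc 0" by simp
      then have "A = {a}" using \<open>finite A\<close> \<open>a \<in> A\<close> card_le_Suc0_iff_eq by blast
      then have "z \<in> C" if "z \<in> S" "z \<noteq> a" for z using that by (auto simp: C_def)
      then show ?thesis using that[of a] cross \<open>a \<in> A\<close> ab commute by metis
    qed
    define B where "B = S - {c}"
    have cardB: "card B \<ge> 2" and finB: "finite B" and BS: "B \<subset> S"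
      using c card3 psubset.hyps by (auto simp: B_def)
    have "twins S d p q" if "twins B d p q" for p q
      using that c by (auto simp: twins_def B_def)
    then have "unique_twins B d"
      using psubset.prems unfolding unique_twins_def by blast
    then obtain xs where xs: "set xs = B" "comb d xs"
      using psubset.IH[OF BS] psubset.prems cardB BS by auto
    define m where "m = length xs - 1"
    have len: "length xs \<ge> 2"
      using cardB xs card_length[of xs] by simp
    then have m: "m < length xs" "0 < m" by (auto simp: m_def)
    have top: "d (xs ! 0) (xs ! m) < d a b"
    proof (rule ccontr)
      assume "\<not> ?thesis"
      moreover have xsS: "xs ! i \<in> S" if "i < length xs" for i
        using that xs BS by auto
      ultimately have eq: "d (xs ! 0) (xs ! m) = d a b"
        using max[of "xs ! 0" "xs ! m"] xsS[of 0] xsS[of m] m by linarith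
      have "d (xs ! m) z = d c z" if z: "z \<in> S" "z \<noteq> c" "z \<noteq> xs ! m" for z
      proof -
        obtain i where i: "i < length xs" "z = xs ! i"
          using z xs by (metis B_def DiffI in_set_conv_nth singletonD)
        then have "i < m"
          using z(3) by (cases "i = m") (auto simp: m_def)
        then have "d z (xs ! m) = d a b"
          using comb_column[OF xs(2) _ m(1), of i] eq i by simp
        then show ?thesis
          using c(2)[of z] z commute[of "xs ! m" z] commute[of c z] by simp
      qed
      moreover have "xs ! m \<in> B" using m xs by auto
      ultimately have tw: "twins S d (xs ! m) c"
        using c(1) by (auto simp: twins_def B_def)
      obtain p q where pq: "p \<in> B" "q \<in> B" "twins S d p q"
      proof (rule closest_pair_twins[of S B])
        show "d p z = d q z" if "p \<in> B" "q \<in> B" "z \<in> S - B" for p q z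
        proof -
          have "z = c" using that by (simp add: B_def)
          then show ?thesis using that c(2)[of p] c(2)[of q] by (simp add: B_def)
        qed
      qed (use psubset.prems cardB finB BS in auto)
      then have "{p, q} = {xs ! m, c}"
        using tw psubset.prems(3) unfolding unique_twins_def by blast
      then show False
        using pq by (auto simp: B_def)
    qed
    have "comb d (xs @ [c])"
    proof -
      have "c \<notin> set xs" using xs by (simp add: B_def)
      then have toc: "d (xs ! i) c = d a b" if "i < length xs" for i
        using c(2)[of "xs ! i"] that xs BS by (metis nth_mem psubsetD)
      have below: "d (xs ! 0) (xs ! i) < d a b" if "0 < i" "i < length xs" for i
      proof (cases "i = m")
        case False
        then have "i < m" using that by (simp add: m_def)
        then have "d (xs ! 0) (xs ! i) < d (xs ! 0) (xs ! m)"
          using comb_less[OF xs(2)] that m by blast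
        then show ?thesis using top by simp
      qed (use top in simp)
      have ne: "xs \<noteq> []" using len by auto
      have first: "(xs @ [c]) ! 0 = xs ! 0"
        using ne by (simp add: nth_append)
      show ?thesis
        unfolding comb_def first
      proof (intro conjI allI impI; (elim conjE)?)
        show "distinct (xs @ [c])"
          using comb_distinct[OF xs(2)] \<open>c \<notin> set xs\<close> by simp
        fix i j assume ij: "i < j" "j < length (xs @ [c])"
        then consider "j < length xs" | "j = length xs" "i < length xs" by fastforce
        note cases = this
        from cases show "d ((xs @ [c]) ! i) ((xs @ [c]) ! j) = d (xs ! 0) ((xs @ [c]) ! j)"
        proof cases
          case 1
          then show ?thesis
            using comb_column[OF xs(2) ij(1)] ij by (simp add: nth_append)
        next
          case 2
          then show ?thesis
            using toc[of i] toc[of 0] ne by (simp add: nth_append)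
        qed
        assume "0 < i"
        from cases show "d (xs ! 0) ((xs @ [c]) ! i) < d (xs ! 0) ((xs @ [c]) ! j)"
        proof cases
          case 1
          then show ?thesis
            using comb_less[OF xs(2) \<open>0 < i\<close> ij(1)] ij by (simp add: nth_append)
        next
          case 2
          then show ?thesis
            using below[OF \<open>0 < i\<close>] toc[of 0] ne by (simp add: nth_append)
        qed
      qed
    qed
    moreover have "set (xs @ [c]) = S"
      using xs c by (auto simp: B_def)
    ultimately show ?thesis by blast
  qed
qed

end

section \<open>Spanning paths\<close>

definition path_graph :: "'a list \<Rightarrow> 'a ugraph" where
  "path_graph xs = (set xs, {{xs ! i, xs ! Suc i} | i. Suc i < length xs})"

lemma path_graph_edge_index:
  assumes "distinct xs" "i < length xs" "j < length xs"
    "{xs ! i, xs ! j} \<in> snd (path_graph xs)"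
  shows "j = Suc i \<or> i = Suc j"
  using assms by (auto simp: path_graph_def doubleton_eq_iff nth_eq_iff_index_eq)

lemma connected_path_graph:
  assumes "xs \<noteq> []"
  shows "connected_graph (path_graph xs)"
proof -
  let ?E = "{(x, y). {x, y} \<in> snd (path_graph xs)}"
  have up: "(xs ! 0, xs ! i) \<in> ?E\<^sup>*" if "i < length xs" for i
    using that
  proof (induction i)
    case (Suc i)
    then have "(xs ! i, xs ! Suc i) \<in> ?E"
      by (auto simp: path_graph_def)
    then show ?case using Suc by (meson Suc_lessD rtrancl.rtrancl_into_rtrancl)
  qed simp
  have "sym ?E" by (auto simp: sym_def insert_commute)
  then have "sym (?E\<^sup>*)" by (rule sym_rtrancl)
  then have "(xs ! i, xs ! j) \<in> ?E\<^sup>*" if "i < length xs" "j < length xs" for i j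
    using up[of i] up[of j] that by (meson rtrancl_trans symD)
  then show ?thesis
    using assms unfolding connected_graph_def
    by (auto simp: path_graph_def in_set_conv_nth)
qed

text \<open>On a cycle, the vertex with the smallest number along the path has both of its neighbours
  numbered one higher, so these coincide; but a cycle has at least three vertices.\<close>

lemma path_graph_acyclic:
  assumes dist: "distinct xs"
  shows "\<not> is_cycle (path_graph xs) c"
proof
  assume cyc: "is_cycle (path_graph xs) c"
  define L where "L = length c"
  have L: "L \<ge> 3" and dc: "distinct c"
    using cyc by (auto simp: is_cycle_def L_def)
  have edge: "{c ! i, c ! (Suc i mod L)} \<in> snd (path_graph xs)" if "i < L" for i
  proof (cases "Suc i < L")
    case True
    then show ?thesis using cyc by (simp add: is_cycle_def L_def)
  next
    case False
    then have last: "Suc i = L" using that by simp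
    have "c \<noteq> []" using L by (auto simp: L_def)
    then have "c ! i = last c" "c ! 0 = hd c"
      using last by (auto simp: L_def last_conv_nth hd_conv_nth dest: sym)
    then show ?thesis using cyc last by (simp add: is_cycle_def)
  qed
  have "\<exists>k<length xs. c ! i = xs ! k" if "i < L" for i
  proof -
    have "c ! i \<in> set xs"
      using edge[OF that] by (auto simp: path_graph_def doubleton_eq_iff)
    then show ?thesis by (metis in_set_conv_nth)
  qed
  then obtain k where k: "\<And>i. i < L \<Longrightarrow> k i < length xs \<and> c ! i = xs ! k i"
    by metis
  have adj: "k (Suc i mod L) = Suc (k i) \<or> k i = Suc (k (Suc i mod L))" if "i < L" for i
    using path_graph_edge_index[OF dist, of "k i" "k (Suc i mod L)"] edge[OF that] k[OF that]
      k[of "Suc i mod L"] L by simp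
  have inj: "i = j" if "i < L" "j < L" "k i = k j" for i j
    using that k[of i] k[of j] nth_eq_iff_index_eq[OF dc, of i j] by (simp add: L_def)
  obtain i where i: "i < L" "\<And>j. j < L \<Longrightarrow> k i \<le> k j"
  proof
    have "{..<L} \<noteq> {}" using L by (auto simp: lessThan_empty_iff)
    then show "arg_min_on k {..<L} < L" "\<And>j. j < L \<Longrightarrow> k (arg_min_on k {..<L}) \<le> k j"
      using arg_min_least[of "{..<L}" _ k] arg_min_if_finite(1)[of "{..<L}" k] by auto
  qed
  \<comment> \<open>The position cyclically preceding \<open>i\<close>.\<close>
  define p where "p = (if i = 0 then L - 1 else i - 1)"
  have p: "p < L" "Suc p mod L = i" "p \<noteq> Suc i mod L"
    using i(1) L by (auto simp: p_def mod_Suc)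
  have "k (Suc i mod L) = Suc (k i)"
    using adj[OF i(1)] i(2)[of "Suc i mod L"] L by fastforce
  moreover have "k p = Suc (k i)"
    using adj[OF p(1)] i(2)[OF p(1)] p by fastforce
  ultimately show False
    using inj[of p "Suc i mod L"] p L by simp
qed

lemma path_graph_is_spanning_tree:
  assumes "distinct xs" "xs \<noteq> []"
  shows "is_spanning_tree (path_graph xs) (complete_graph (set xs))"
proof -
  have "simple_graph (path_graph xs)"
    using assms(1) by (auto simp: simple_graph_def path_graph_def nth_eq_iff_index_eq)
  moreover have "snd (path_graph xs) \<subseteq> snd (complete_graph (set xs))"
  proof
    fix e assume "e \<in> snd (path_graph xs)"
    then obtain i where "Suc i < length xs" "e = {xs ! i, xs ! Suc i}"
      by (auto simp: path_graph_def)
    moreover from this have "xs ! i \<noteq> xs ! Suc i"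
      using assms(1) by (simp add: nth_eq_iff_index_eq)
    ultimately show "e \<in> snd (complete_graph (set xs))"
      by (auto simp: complete_graph_def) (metis Suc_lessD nth_mem)
  qed
  ultimately show ?thesis
    using assms path_graph_acyclic connected_path_graph
    by (auto simp: is_spanning_tree_def is_tree_def path_graph_def complete_graph_def)
qed

text \<open>To every vertex other than the root \<open>r\<close> one assigns an edge to a vertex closer to \<open>r\<close>. No edge
  is assigned to both of its ends, since each of them would be closer than the other.\<close>

lemma connected_graph_parent_edges:
  assumes "connected_graph G" "r \<in> fst G"
  obtains e where "inj_on e (fst G - {r})"
    "\<And>v. v \<in> fst G - {r} \<Longrightarrow> e v \<in> snd G \<and> v \<in> e v"
proof -
  let ?E = "{(x, y). {x, y} \<in> snd G}"
  define depth where "depth v = (LEAST k. (r, v) \<in> ?E ^^ k)" for v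
  have "\<exists>u. {u, v} \<in> snd G \<and> depth u < depth v" if v: "v \<in> fst G - {r}" for v
  proof -
    have "(r, v) \<in> ?E\<^sup>*" using assms v by (auto simp: connected_graph_def)
    then have dv: "(r, v) \<in> ?E ^^ depth v"
      unfolding depth_def by (meson LeastI rtrancl_imp_relpow)
    then obtain k where k: "depth v = Suc k"
      using v by (cases "depth v") auto
    then obtain u where u: "(r, u) \<in> ?E ^^ k" "(u, v) \<in> ?E"
      using dv by auto
    have "depth u \<le> k" unfolding depth_def using u(1) by (rule Least_le)
    then show ?thesis using u k by auto
  qed
  then obtain par where par: "\<And>v. v \<in> fst G - {r} \<Longrightarrow> {par v, v} \<in> snd G \<and> depth (par v) < depth v"
    by metis
  show ?thesis
  proof
    show "inj_on (\<lambda>v. {par v, v}) (fst G - {r})"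
    proof (rule inj_onI, rule ccontr)
      fix v w assume vw: "v \<in> fst G - {r}" "w \<in> fst G - {r}" "{par v, v} = {par w, w}" "v \<noteq> w"
      then have "par v = w" "par w = v" by (auto simp: doubleton_eq_iff)
      then show False using par[OF vw(1)] par[OF vw(2)] by simp
    qed
  qed (use par in auto)
qed

context Ultrametric_space
begin

lemma total_weight_path_graph:
  assumes "distinct xs"
  shows "total_weight d (path_graph xs) = (\<Sum>i<length xs - 1. d (xs ! i) (xs ! Suc i))"
proof -
  let ?e = "\<lambda>i. {xs ! i, xs ! Suc i}"
  have "snd (path_graph xs) = ?e ` {..<length xs - 1}"
    by (auto simp: path_graph_def)
  moreover have "inj_on ?e {..<length xs - 1}"
    using assms by (auto simp: inj_on_def doubleton_eq_iff nth_eq_iff_index_eq)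
  moreover have "edge_weight d (?e i) = d (xs ! i) (xs ! Suc i)" if "i < length xs - 1" for i
    using that assms by (intro edge_weight_doubleton) (simp add: nth_eq_iff_index_eq)
  ultimately show ?thesis
    by (simp add: total_weight_def sum.reindex)
qed

text \<open>An edge at \<open>xs ! Suc i\<close> has the constant of a column with number at least \<open>Suc i\<close> as its
  weight, hence weighs at least as much as the path's step into \<open>xs ! Suc i\<close>. Summing over the
  distinct parent edges of the points \<open>xs ! Suc i\<close> bounds the weight of any spanning tree.\<close>

lemma comb_path_minimal:
  assumes comb: "comb d xs" and X: "set xs = X" and ne: "xs \<noteq> []"
    and T: "is_spanning_tree T (complete_graph X)"
  shows "total_weight d (path_graph xs) \<le> total_weight d T"
proof -
  let ?n = "length xs"
  let ?v = "\<lambda>i. xs ! Suc i"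
  have dist: "distinct xs" by (rule comb_distinct[OF comb])
  have fstT: "fst T = X" and edges: "snd T \<subseteq> {{x, y} | x y. x \<in> X \<and> y \<in> X \<and> x \<noteq> y}"
    and conn: "connected_graph T"
    using T by (auto simp: is_spanning_tree_def is_tree_def complete_graph_def)
  have "finite X" using X by auto
  have "snd T \<subseteq> Pow X"
  proof
    fix u assume "u \<in> snd T"
    then obtain x y where "u = {x, y}" "x \<in> X" "y \<in> X" using edges by auto
    then show "u \<in> Pow X" by simp
  qed
  then have finT: "finite (snd T)"
    by (rule finite_subset) (simp add: \<open>finite X\<close>)
  have r: "xs ! 0 \<in> fst T" using fstT X ne nth_mem[of 0 xs] by simp
  obtain e where inj: "inj_on e (X - {xs ! 0})"
    and e: "\<And>v. v \<in> X - {xs ! 0} \<Longrightarrow> e v \<in> snd T \<and> v \<in> e v"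
    using connected_graph_parent_edges[OF conn r] unfolding fstT by blast
  have v: "?v i \<in> X - {xs ! 0}" if "i < ?n - 1" for i
    using that dist X ne nth_eq_iff_index_eq[of xs "Suc i" 0] by auto
  have weight: "d (xs ! i) (?v i) \<le> edge_weight d (e (?v i))" if i: "i < ?n - 1" for i
  proof -
    obtain y where y: "y \<in> X" "?v i \<noteq> y" "e (?v i) = {?v i, y}"
    proof -
      have "e (?v i) \<in> snd T" "?v i \<in> e (?v i)" using e[OF v[OF i]] by simp_all
      moreover from this obtain x z where "x \<in> X" "z \<in> X" "x \<noteq> z" "e (?v i) = {x, z}"
        using edges by blast
      ultimately show ?thesis
        using that[of x] that[of z] by (metis empty_iff insert_commute insert_iff)
    qed
    then obtain k where k: "k < ?n" "y = xs ! k"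
      using X by (metis in_set_conv_nth)
    then have "k \<noteq> Suc i" using y by auto
    then have "d (?v i) y = d (xs ! 0) (xs ! max (Suc i) k)"
      using comb_dist[OF comb, of "Suc i" k] k i by simp
    moreover have "d (xs ! 0) (?v i) \<le> d (xs ! 0) (xs ! max (Suc i) k)"
      using comb_less[OF comb, of "Suc i" k] k i by (auto simp: max_def less_le)
    moreover have "d (xs ! i) (?v i) = d (xs ! 0) (?v i)"
      using comb_column[OF comb, of i "Suc i"] i by simp
    ultimately show ?thesis
      using y edge_weight_doubleton by simp
  qed
  have inj': "inj_on (\<lambda>i. e (?v i)) {..<?n - 1}"
  proof (rule inj_onI)
    fix i j assume ij: "i \<in> {..<?n - 1}" "j \<in> {..<?n - 1}" "e (?v i) = e (?v j)"
    then have "?v i = ?v j" using v[of i] v[of j] by (auto intro: inj_onD[OF inj])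
    then show "i = j" using ij dist by (simp add: nth_eq_iff_index_eq)
  qed
  have "total_weight d (path_graph xs) \<le> (\<Sum>i<?n - 1. edge_weight d (e (?v i)))"
    using weight by (auto simp: total_weight_path_graph[OF dist] intro: sum_mono)
  also have "\<dots> = (\<Sum>u\<in>(\<lambda>i. e (?v i)) ` {..<?n - 1}. edge_weight d u)"
    using inj' by (simp add: sum.reindex)
  also have "\<dots> \<le> total_weight d T"
    unfolding total_weight_def
  proof (rule sum_mono2[OF finT])
    show "(\<lambda>i. e (?v i)) ` {..<?n - 1} \<subseteq> snd T"
      using e v by auto
    show "0 \<le> edge_weight d u" if u: "u \<in> snd T - (\<lambda>i. e (?v i)) ` {..<?n - 1}" for u
    proof -
      have "u \<in> snd T" using u by simp
      then obtain x y where "u = {x, y}" "x \<noteq> y" using edges by auto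
      then show ?thesis by (simp add: edge_weight_doubleton)
    qed
  qed
  finally show ?thesis .
qed

lemma comb_path_in_min_spanning_paths:
  assumes "comb d xs" "set xs = X" "xs \<noteq> []"
  shows "path_graph xs \<in> min_spanning_paths X d" "path_numbering (path_graph xs) xs"
proof -
  have dist: "distinct xs" by (rule comb_distinct[OF assms(1)])
  show num: "path_numbering (path_graph xs) xs"
    using dist assms(3) by (simp add: path_numbering_def path_graph_def)
  have "is_spanning_tree (path_graph xs) (complete_graph X)"
    using path_graph_is_spanning_tree[OF dist assms(3)] assms(2) by simp
  then show "path_graph xs \<in> min_spanning_paths X d"
    using comb_path_minimal[OF assms] num
    by (auto simp: min_spanning_paths_def is_min_spanning_tree_def)
qed

end

section \<open>Rigidity and monotone spanning paths\<close>

theorem proposition3p8: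
  fixes X :: "'a set" and d :: "'a \<Rightarrow> 'a \<Rightarrow> real"
  assumes "Ultrametric_space X d" and "finite X" and "card X \<ge> 2"
  shows "(X, d) \<in> as_rigid_as_possible \<longleftrightarrow>
    (\<exists>P \<in> min_spanning_paths X d. \<exists>xs. path_numbering P xs \<and>
       strictly_monotone (path_spectrum d xs))"
proof -
  interpret Ultrametric_space X d by fact
  show ?thesis
  proof
    assume "(X, d) \<in> as_rigid_as_possible"
    then have "unique_twins X d"
      using as_rigid_as_possible_iff rigid_imp_unique_twins assms(2,3) by blast
    then obtain xs where xs: "set xs = X" "comb d xs"
      using unique_twins_imp_comb assms(2,3) by blast
    have "xs \<noteq> []" using xs assms(3) by auto
    moreover have "strictly_monotone (path_spectrum d xs)"
      using xs comb_iff_sorted_spectrum[of xs] comb_distinct[OF xs(2)]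
      by (simp add: strictly_monotone_def)
    ultimately show "\<exists>P \<in> min_spanning_paths X d. \<exists>xs. path_numbering P xs \<and>
       strictly_monotone (path_spectrum d xs)"
      using comb_path_in_min_spanning_paths[OF xs(2,1)] by blast
  next
    assume "\<exists>P \<in> min_spanning_paths X d. \<exists>xs. path_numbering P xs \<and>
       strictly_monotone (path_spectrum d xs)"
    then obtain P xs where P: "P \<in> min_spanning_paths X d" "path_numbering P xs"
      and mono: "strictly_monotone (path_spectrum d xs)"
      by blast
    have "set xs = X" "distinct xs"
      using P by (auto simp: min_spanning_paths_def is_min_spanning_tree_def
          is_spanning_tree_def complete_graph_def path_numbering_def)
    then obtain ys where "set ys = X" "comb d ys"
      using strictly_monotone_spectrum_imp_comb mono by blast
    then show "(X, d) \<in> as_rigid_as_possible"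
      using comb_imp_rigid as_rigid_as_possible_iff assms(2,3) by blast
  qed
qed

end
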